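(* Let $X$ be a Banach space with dual $X^{*}$, let $C\subset X$ be closed and convex, and let $A:X\rightrightarrows X^{*}$ be a maximal monotone operator of type weak-(FPV) such that $\operatorname{cen}D(A)\cap\operatorname{int}C\neq\emptyset$. Then $A+N_{C}$ is maximal monotone, where $N_C:X\rightrightarrows X^*$ denotes the normal cone operator of $C$.
   Context: Banach spaces are over the real numbers, and $\langle x,x^{*}\rangle=x^{*}(x)$ for $(x,x^{*})\in X\times X^{*}$. A multi-valued operator $A:X\rightrightarrows X^{*}$ is identified with its graph $\{(x,x^* )\in X\times X^*\mid x^*\in A(x)\}$; its domain is $D(A)=\{x\in X\mid A(x)\neq\emptyset\}$. $A$ is monotone if $\langle x-y,x^{*}-y^{*}\rangle\ge 0$ for all $(x,x^* ),(y,y^* )\in A$, and maximal monotone if it is monotone and its graph is not properly contained in the graph of another monotone operator $X\rightrightarrows X^*$. The sum is defined pointwise: $(A+N_C)(x)=\{a^*+n^*\mid a^*\in A(x),\ n^*\in N_C(x)\}$, with domain $D(A)\cap D(N_C)$. Normal cone: $N_C(x)=\{x^*\in X^*\mid \langle y-x,x^*\rangle\le 0\ \text{for all } y\in C\}$ if $x\in C$, and $N_C(x)=\emptyset$ if $x\notin C$. $\operatorname{int}C$ is the norm interior of $C$. Center of the domain: $x\in\operatorname{cen}D(A)$ means that the segment $[x,y]:=\{tx+(1-t)y\mid 0\le t\le 1\}$ is contained in $D(A)$ for every $y\in D(A)$. Monotonically related: $z=(x,x^{*})\in X\times X^*$ is monotonically related to $S\subset X\times X^{*}$ if $\langle x-s,x^{*}-s^{*}\rangle\ge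 0$ for all $(s,s^{*})\in S$. For $V\subset X$, $A|_{V}$ denotes the operator with graph $\{(a,a^* )\in A\mid a\in V\}$. Type weak-(FPV): $A$ is of type weak-(FPV) if for every open convex $V\subset X$ with $V\cap D(A)\neq\emptyset$, whenever $z=(x,x^{*})\in X\times X^*$ is monotonically related to $A|_{V}$ and $x\in V$, then $x\in D(A)$. Equivalently, for every such $V$ and every $(x,x^{*})\in (V\setminus D(A))\times X^{*}$ there is $(a,a^{*})\in A|_{V}$ such that $\langle x-a,x^{*}-a^{*}\rangle<0$. *)

theory Defs
  imports "HOL-Analysis.Analysis"
begin

type_synonym 'a dual = "'a \<Rightarrow>\<^sub>L real"

(* A multi-valued operator from X to its dual is represented by its graph. *)
type_synonym 'a operator = "('a \<times> 'a dual) set"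

abbreviation pairing :: "'a::real_normed_vector \<Rightarrow> 'a dual \<Rightarrow> real" where
  "pairing x x' \<equiv> blinfun_apply x' x"

definition op_dom :: "'a::real_normed_vector operator \<Rightarrow> 'a set" where
  "op_dom A = {x. \<exists>x'. (x, x') \<in> A}"

definition monotone_op :: "'a::real_normed_vector operator \<Rightarrow> bool" where
  "monotone_op A \<longleftrightarrow>
     (\<forall>x x' y y'. (x, x') \<in> A \<longrightarrow> (y, y') \<in> A \<longrightarrow> pairing (x - y) (x' - y') \<ge> 0)"

definition maximal_monotone_op :: "'a::real_normed_vector operator \<Rightarrow> bool" where
  "maximal_monotone_op A \<longleftrightarrow> monotone_op A \<and> \<not> (\<exists>B. monotone_op B \<and> A \<subset> B)"

definition op_sum :: "'a::real_normed_vector operator \<Rightarrow> 'a operator \<Rightarrow> 'a operator" where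
  "op_sum A B = {(x, a' + b') | x a' b'. (x, a') \<in> A \<and> (x, b') \<in> B}"

definition normal_cone :: "'a::real_normed_vector set \<Rightarrow> 'a operator" where
  "normal_cone C = {(x, x'). x \<in> C \<and> (\<forall>y\<in>C. pairing (y - x) x' \<le> 0)}"

definition cen :: "'a::real_vector set \<Rightarrow> 'a set" where
  "cen S = {x. \<forall>y\<in>S. closed_segment x y \<subseteq> S}"

definition monotonically_related ::
    "'a::real_normed_vector \<times> 'a dual \<Rightarrow> 'a operator \<Rightarrow> bool" where
  "monotonically_related z S \<longleftrightarrow>
     (\<forall>(s, s')\<in>S. pairing (fst z - s) (snd z - s') \<ge> 0)"

definition op_restrict :: "'a::real_normed_vector operator \<Rightarrow> 'a set \<Rightarrow> 'a operator" where
  "op_restrict A V = {(a, a'). (a, a') \<in> A \<and> a \<in> V}"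

definition weak_FPV :: "'a::real_normed_vector operator \<Rightarrow> bool" where
  "weak_FPV A \<longleftrightarrow>
     (\<forall>V. open V \<and> convex V \<and> V \<inter> op_dom A \<noteq> {} \<longrightarrow>
        (\<forall>x x'. monotonically_related (x, x') (op_restrict A V) \<and> x \<in> V \<longrightarrow> x \<in> op_dom A))"

end

theory Submission
  imports Defs
begin

text \<open>
  Write \<open>c(x, x') = x'(x)\<close> and \<open>T = A + N\<^sub>C\<close>, and fix a point \<open>p\<close> of \<open>cen D(A)\<close> in the interior
  of \<open>C\<close>. The operator \<open>T\<close> is clearly monotone; what has to be shown is that every \<open>z = (x, x')\<close>
  monotonically related to \<open>T\<close> lies in \<open>T\<close>.

  First, \<open>x\<close> belongs to \<open>C\<close>. If it did not, consider a thin convex tube around the segment from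
  \<open>p\<close> to \<open>x\<close>. Let \<open>a\<close> be a point of \<open>D(A)\<close> in the tube but outside \<open>C\<close>. As \<open>p\<close> is in the center,
  the segment from \<open>p\<close> to \<open>a\<close> leaves \<open>C\<close> at a boundary point \<open>b\<close> that is still in \<open>D(A)\<close>. A functional
  \<open>m\<close> supporting \<open>C\<close> at \<open>b\<close> satisfies \<open>m(x - b) > 0\<close>, because the tube is thin, and all multiples of \<open>m\<close>
  may be added to the values of \<open>A\<close> at \<open>b\<close>, which destroys the relation of \<open>z\<close> to \<open>T\<close>. So inside the
  tube \<open>D(A)\<close> stays in \<open>C\<close>, where \<open>T\<close> extends \<open>A\<close>; hence \<open>z\<close> is related to \<open>A\<close> restricted to the tube
  and the weak (FPV) property puts \<open>x\<close> itself into \<open>D(A)\<close>, a contradiction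
  (\<open>domain_tube_subset\<close>, \<open>monotonically_related_in_constraint\<close>).

  Secondly, no point \<open>w\<close> of the product space satisfies \<open>c(w - \<beta>) \<ge> \<epsilon> > 0\<close> for all \<open>\<beta> \<in> T\<close>
  (\<open>op_sum_normal_cone_almost_unrelated\<close>). Such a strict inequality survives a small move of \<open>w\<close>
  towards a point of \<open>T\<close> above \<open>p\<close>. That move brings the base point from \<open>C\<close> into the interior of \<open>C\<close>,
  where weak (FPV) applies and puts it into \<open>D(T)\<close>; but above a point of \<open>D(T)\<close> the pairing
  \<open>c(w - \<beta>)\<close> can be made zero.

  Finally one looks for \<open>u \<in> N\<^sub>C(x)\<close> such that \<open>(x, x' - u)\<close> is related to \<open>A\<close>. By a separation argument
  using the interior point \<open>p\<close>, such a \<open>u\<close> exists as soon as convex combinations of the numbers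
  \<open>c(z - \<alpha>\<^sub>i)\<close>, \<open>\<alpha>\<^sub>i \<in> A\<close>, are nonnegative whenever the same combination of the base points lies in \<open>C\<close>
  (\<open>sandwich_functional\<close>). This nonnegativity follows from the second step, applied to points
  close to \<open>z\<close> on the segment joining \<open>z\<close> to the convex combination of the \<open>\<alpha>\<^sub>i\<close>, by differentiating at \<open>z\<close>
  (\<open>monotonically_related_graph_hull\<close>). Maximality of \<open>A\<close> then gives \<open>(x, x' - u) \<in> A\<close>.

  The supporting and separating functionals come from a Hahn--Banach theorem
  (\<open>supporting_functional\<close>), obtained by enlarging a convex cone to a maximal one.
\<close>

section \<open>Supporting functionals of convex sets in normed spaces\<close>

text \<open>
  Adjoining the ray through \<open>x\<close> to \<open>Q\<close> gives a convex cone. If \<open>x \<notin> Q\<close>, this cone contains \<open>- e\<close> by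
  maximality; solving the resulting equation for \<open>- x\<close> shows that \<open>- x\<close> is a multiple of an
  element of \<open>Q\<close>. So the preorder defined by a maximal cone is total.
\<close>
lemma maximal_convex_cone_total:
  fixes Q :: "'b::real_vector set"
  assumes Q: "convex_cone Q" and e: "e \<in> Q" and me: "- e \<notin> Q"
    and max: "\<And>R. convex_cone R \<Longrightarrow> - e \<notin> R \<Longrightarrow> Q \<subseteq> R \<Longrightarrow> R = Q"
  shows "x \<in> Q \<or> - x \<in> Q"
proof (rule ccontr)
  assume neg: "\<not> (x \<in> Q \<or> - x \<in> Q)"
  define R where "R = {k + t *\<^sub>R x | k t. k \<in> Q \<and> 0 \<le> t}"
  have "convex_cone R"
    unfolding convex_cone_iff
  proof (intro conjI ballI allI impI)
    show "0 \<in> R"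
      using convex_cone_contains_0[OF Q] by (force simp: R_def)
  next
    fix u v assume "u \<in> R" "v \<in> R"
    then obtain k s l t where "u = k + s *\<^sub>R x" "v = l + t *\<^sub>R x" "k \<in> Q" "l \<in> Q" "0 \<le> s" "0 \<le> t"
      by (auto simp: R_def)
    then have "u + v = (k + l) + (s + t) *\<^sub>R x" "k + l \<in> Q" "0 \<le> s + t"
      using convex_cone_add[OF Q] by (auto simp: algebra_simps)
    then show "u + v \<in> R" unfolding R_def by blast
  next
    fix u c assume "u \<in> R" "0 \<le> (c::real)"
    then obtain k s where "u = k + s *\<^sub>R x" "k \<in> Q" "0 \<le> s"
      by (auto simp: R_def)
    then have "c *\<^sub>R u = c *\<^sub>R k + (c * s) *\<^sub>R x" "c *\<^sub>R k \<in> Q" "0 \<le> c * s"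
      using convex_cone_scaleR[OF Q] \<open>0 \<le> c\<close> by (auto simp: algebra_simps)
    then show "c *\<^sub>R u \<in> R" unfolding R_def by blast
  qed
  moreover have "Q \<subseteq> R"
    by (force simp: R_def)
  moreover have "x \<in> R"
    using convex_cone_contains_0[OF Q] unfolding R_def by (intro CollectI exI[of _ 0] exI[of _ 1]) simp
  ultimately have "- e \<in> R"
    using max neg by metis
  then obtain k t where kt: "- e = k + t *\<^sub>R x" "k \<in> Q" "0 \<le> t"
    by (auto simp: R_def)
  have "t \<noteq> 0" using kt me by auto
  have "t *\<^sub>R (- x) = e + k"
    using arg_cong[OF kt(1), of uminus] by simp
  have "- x = (1 / t) *\<^sub>R (t *\<^sub>R (- x))"
    using \<open>t \<noteq> 0\<close> by simp
  also have "\<dots> = (1 / t) *\<^sub>R (e + k)"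
    unfolding \<open>t *\<^sub>R (- x) = e + k\<close> ..
  finally have "- x = (1 / t) *\<^sub>R (e + k)" .
  then have "- x \<in> Q"
    using convex_cone_scaleR[OF Q _ convex_cone_add[OF Q e kt(2)], of "1/t"] kt(3) by simp
  then show False using neg by simp
qed

lemma maximal_convex_cone_exists:
  fixes Q :: "'b::real_vector set"
  assumes Q: "convex_cone Q" and "v \<notin> Q"
  obtains M where "convex_cone M" "v \<notin> M" "Q \<subseteq> M"
    "\<And>R. convex_cone R \<Longrightarrow> v \<notin> R \<Longrightarrow> M \<subseteq> R \<Longrightarrow> R = M"
proof -
  let ?F = "{R. convex_cone R \<and> v \<notin> R \<and> Q \<subseteq> R}"
  have "\<exists>M\<in>?F. \<forall>R\<in>?F. M \<subseteq> R \<longrightarrow> R = M"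
  proof (rule subset_Zorn_nonempty)
    show "?F \<noteq> {}" using assms by blast
  next
    fix \<C> assume ne: "\<C> \<noteq> {}" and ch: "subset.chain ?F \<C>"
    have F: "\<And>R. R \<in> \<C> \<Longrightarrow> convex_cone R \<and> v \<notin> R \<and> Q \<subseteq> R"
      using ch by (auto simp: subset.chain_def)
    have "convex_cone (\<Union>\<C>)"
      unfolding convex_cone_iff
    proof (intro conjI ballI allI impI)
      show "0 \<in> \<Union>\<C>" using ne F convex_cone_contains_0 by blast
    next
      fix x y assume "x \<in> \<Union>\<C>" "y \<in> \<Union>\<C>"
      then obtain R S where RS: "R \<in> \<C>" "S \<in> \<C>" "x \<in> R" "y \<in> S" by blast
      have "R \<subseteq> S \<or> S \<subseteq> R" using ch RS by (auto simp: subset_chain_def)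
      then show "x + y \<in> \<Union>\<C>" using RS F convex_cone_add by (meson UnionI subsetD)
    next
      fix x c assume "x \<in> \<Union>\<C>" "0 \<le> (c::real)"
      then show "c *\<^sub>R x \<in> \<Union>\<C>" using F convex_cone_scaleR by (meson UnionE UnionI)
    qed
    then show "\<Union>\<C> \<in> ?F" using ne F by blast
  qed
  then obtain M where M: "M \<in> ?F" and mx: "\<forall>R\<in>?F. M \<subseteq> R \<longrightarrow> R = M" ..
  show thesis
  proof (rule that)
    fix R assume "convex_cone R" "v \<notin> R" "M \<subseteq> R"
    moreover from this have "R \<in> ?F" using M order_trans[of Q M R] by simp
    ultimately show "R = M" using mx by simp
  qed (use M in auto)
qed

text \<open>
  In the total preorder given by a maximal cone \<open>M\<close>, the vector \<open>e\<close> is an order unit, and the real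
  line spanned by \<open>e\<close> meets every class up to an infinitesimal. The number \<open>f x\<close> is the position of
  \<open>x\<close> on this line. One half of additivity holds for any cone with order unit; the other half
  uses that every \<open>t e\<close> with \<open>t < f x\<close> lies below \<open>x\<close>, which is totality.
\<close>
lemma cone_positive_functional:
  fixes Q :: "'b::real_normed_vector set"
  assumes "convex_cone Q" "e \<in> interior Q" "- e \<notin> Q"
  obtains f :: "'b \<Rightarrow>\<^sub>L real" where "blinfun_apply f e = 1" "\<And>x. x \<in> Q \<Longrightarrow> 0 \<le> blinfun_apply f x"
proof -
  obtain M where M: "convex_cone M" "- e \<notin> M" "Q \<subseteq> M"
    and mx: "\<And>R. convex_cone R \<Longrightarrow> - e \<notin> R \<Longrightarrow> M \<subseteq> R \<Longrightarrow> R = M"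
    using maximal_convex_cone_exists[OF assms(1,3)] by metis
  have eM: "e \<in> M" using assms(2) M(3) interior_subset by blast
  have total: "\<And>x. x \<in> M \<or> - x \<in> M"
    using maximal_convex_cone_total[OF M(1) eM M(2) mx] by blast
  note add = convex_cone_add[OF M(1)] and scale = convex_cone_scaleR[OF M(1)]
  obtain r where "r > 0" and r: "cball e r \<subseteq> M"
    using assms(2) M(3) unfolding mem_interior_cball by blast
  have pos: "0 \<le> t" if "t *\<^sub>R e \<in> M" for t
  proof (rule ccontr)
    assume "\<not> 0 \<le> t"
    then have "- e = (1 / (- t)) *\<^sub>R (t *\<^sub>R e)" "0 \<le> 1 / (- t)" by auto
    then show False using scale that M(2) by metis
  qed
  define T where "T x = {t. t *\<^sub>R e - x \<in> M}" for x
  have unit: "(norm x / r) *\<^sub>R e - x \<in> M" for x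
  proof (cases "x = 0")
    case True
    then show ?thesis using convex_cone_contains_0[OF M(1)] by simp
  next
    case False
    then have "e - (r / norm x) *\<^sub>R x \<in> cball e r" using \<open>r > 0\<close> by (simp add: dist_norm)
    then have "(norm x / r) *\<^sub>R (e - (r / norm x) *\<^sub>R x) \<in> M" using r \<open>r > 0\<close> by (intro scale) auto
    then show ?thesis using False \<open>r > 0\<close> by (simp add: algebra_simps)
  qed
  have T_lower: "- s \<le> t" if "t \<in> T x" "s \<in> T (- x)" for s t x
  proof -
    have "(t *\<^sub>R e - x) + (s *\<^sub>R e - - x) \<in> M" using that by (intro add) (auto simp: T_def)
    then have "(t + s) *\<^sub>R e \<in> M" by (simp add: algebra_simps)
    then show ?thesis using pos by force
  qed
  have ne: "norm x / r \<in> T x" for x using unit by (simp add: T_def)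
  have bdd: "bdd_below (T x)" for x
    using T_lower[OF _ ne[of "- x"]] by (intro bdd_belowI) auto
  define f where "f x = Inf (T x)" for x
  have le: "f x \<le> t" if "t *\<^sub>R e - x \<in> M" for x t
    unfolding f_def using that by (intro cInf_lower bdd) (simp add: T_def)
  have ge: "t \<le> f x" if "x - t *\<^sub>R e \<in> M" for x t
  proof -
    have "- t \<in> T (- x)" using that by (simp add: T_def)
    then show ?thesis
      unfolding f_def using T_lower[of _ x "- t"] ne[of x] by (intro cInf_greatest) auto
  qed
  have near: "\<exists>t. t *\<^sub>R e - x \<in> M \<and> t < f x + d" if "d > 0" for x d
  proof -
    have "Inf (T x) < f x + d" using that by (simp add: f_def)
    then show ?thesis using cInf_lessD[of "T x"] ne[of x] by (auto simp: T_def)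
  qed
  have near': "\<exists>t. x - t *\<^sub>R e \<in> M \<and> f x - d < t" if "d > 0" for x d
  proof -
    have "\<not> (f x - d / 2) *\<^sub>R e - x \<in> M" using le that by fastforce
    then have "x - (f x - d / 2) *\<^sub>R e \<in> M" using total by (metis minus_diff_eq)
    then show ?thesis using that by (intro exI[of _ "f x - d/2"]) simp
  qed
  have f_add: "f (x + y) = f x + f y" for x y
  proof (rule antisym)
    show "f (x + y) \<le> f x + f y"
    proof (rule field_le_epsilon)
      fix d :: real assume "0 < d"
      obtain s t where st: "s *\<^sub>R e - x \<in> M" "s < f x + d / 2" "t *\<^sub>R e - y \<in> M" "t < f y + d / 2"
        using near[of "d/2"] \<open>0 < d\<close> by (metis half_gt_zero)
      have "(s + t) *\<^sub>R e - (x + y) \<in> M" using add[OF st(1,3)] by (simp add: algebra_simps)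
      then show "f (x + y) \<le> f x + f y + d" using le st(2,4) by fastforce
    qed
    show "f x + f y \<le> f (x + y)"
    proof (rule field_le_epsilon)
      fix d :: real assume "0 < d"
      obtain s t where st: "x - s *\<^sub>R e \<in> M" "f x - d / 2 < s" "y - t *\<^sub>R e \<in> M" "f y - d / 2 < t"
        using near'[of "d/2"] \<open>0 < d\<close> by (metis half_gt_zero)
      have "(x + y) - (s + t) *\<^sub>R e \<in> M" using add[OF st(1,3)] by (simp add: algebra_simps)
      then show "f x + f y \<le> f (x + y) + d" using ge st(2,4) by fastforce
    qed
  qed
  have f_le: "f x \<le> norm x / r" for x using le[OF unit] .
  have f_ge0: "0 \<le> f x" if "x \<in> M" for x using ge[of x 0] that by simp
  have f0: "f 0 = 0" using f_add[of 0 0] by simp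
  have f_minus: "f (- x) = - f x" for x using f_add[of x "- x"] f0 by simp
  have abs: "\<bar>f x\<bar> \<le> norm x * (1 / r)" for x
    using f_le[of x] f_le[of "- x"] f_minus[of x] by simp
  have f_scale_pos: "f (c *\<^sub>R x) = c * f x" if "0 < c" for c x
  proof -
    have "f (c *\<^sub>R x) \<le> c * f x" if "0 < c" for c x
    proof -
      have "f (c *\<^sub>R x) / c \<le> f x + d" if d: "0 < d" for d
      proof -
        obtain t where t: "t *\<^sub>R e - x \<in> M" "t < f x + d" using near[OF d] by blast
        have "c *\<^sub>R (t *\<^sub>R e - x) \<in> M" using t \<open>0 < c\<close> by (intro scale) auto
        then have "f (c *\<^sub>R x) \<le> c * t" by (intro le) (simp add: algebra_simps)
        then have "f (c *\<^sub>R x) / c \<le> t" using \<open>0 < c\<close> by (simp add: divide_le_eq mult.commute)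
        then show ?thesis using t(2) by linarith
      qed
      then have "f (c *\<^sub>R x) / c \<le> f x" by (rule field_le_epsilon)
      then show ?thesis using \<open>0 < c\<close> by (simp add: field_simps)
    qed
    from this[OF that, of x] this[of "1 / c" "c *\<^sub>R x"] show ?thesis
      using that by (simp add: field_simps)
  qed
  have f_scale: "f (c *\<^sub>R x) = c * f x" for c x
  proof (cases c "0::real" rule: linorder_cases)
    case less
    then show ?thesis using f_scale_pos[of "- c" x] f_minus[of "c *\<^sub>R x"] by simp
  qed (use f0 f_scale_pos in auto)
  have bl: "bounded_linear f"
    by (rule bounded_linear_intro[of _ "1 / r"]) (use f_add f_scale abs in auto)
  show thesis
  proof (rule that[of "Blinfun f"])
    have "f e = 1"
      using le[of 1 e] ge[of e 1] convex_cone_contains_0[OF M(1)] by force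
    then show "Blinfun f e = 1" using bl by (simp add: bounded_linear_Blinfun_apply)
    show "0 \<le> Blinfun f x" if "x \<in> Q" for x
      using that M(3) f_ge0 bl by (auto simp: bounded_linear_Blinfun_apply)
  qed
qed

lemma convex_shrink_interior:
  fixes S :: "'b::real_normed_vector set"
  assumes "convex S" "c \<in> interior S" "x \<in> S" "0 < t" "t \<le> 1"
  shows "(1 - t) *\<^sub>R x + t *\<^sub>R c \<in> interior S"
proof (rule interiorI)
  show "open ((\<lambda>y. (1 - t) *\<^sub>R x + t *\<^sub>R y) ` interior S)"
    using assms(4) by (intro open_affinity) auto
  show "(\<lambda>y. (1 - t) *\<^sub>R x + t *\<^sub>R y) ` interior S \<subseteq> S"
  proof (rule image_subsetI)
    fix y assume "y \<in> interior S"
    then have "y \<in> S" using interior_subset by blast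
    then show "(1 - t) *\<^sub>R x + t *\<^sub>R y \<in> S" using assms(3-5) by (intro convexD[OF assms(1)]) auto
  qed
  show "(1 - t) *\<^sub>R x + t *\<^sub>R c \<in> (\<lambda>y. (1 - t) *\<^sub>R x + t *\<^sub>R y) ` interior S"
    using assms(2) by (rule imageI)
qed

text \<open>
  The cone generated by \<open>z - K\<close> has \<open>e = z - k\<close> in its interior. If it contained \<open>- e\<close>, then \<open>z\<close>
  would be a proper convex combination of the interior point \<open>k\<close> and a point of \<open>K\<close>, hence interior.
\<close>
lemma supporting_functional:
  fixes K :: "'b::real_normed_vector set"
  assumes "convex K" "k \<in> interior K" "z \<notin> interior K"
  obtains f :: "'b \<Rightarrow>\<^sub>L real" where "f \<noteq> 0" "\<And>y. y \<in> K \<Longrightarrow> blinfun_apply f y \<le> blinfun_apply f z"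
proof -
  define Q where "Q = conic hull ((\<lambda>y. z - y) ` K)"
  have kK: "k \<in> K" using assms(2) interior_subset by blast
  have "convex ((\<lambda>y. z - y) ` K)"
    using convex_translation[OF convex_negations[OF assms(1)], of z] by (simp add: image_image)
  then have "convex_cone Q"
    unfolding Q_def convex_cone_def
    using convex_conic_hull conic_conic_hull kK by (auto simp: conic_hull_eq_empty)
  moreover have "z - k \<in> interior Q"
  proof (rule interiorI)
    show "open ((\<lambda>y. z - y) ` interior K)"
      using open_affinity[of "interior K" "-1" z] by simp
    have "(\<lambda>y. z - y) ` interior K \<subseteq> (\<lambda>y. z - y) ` K" using interior_subset by blast
    then show "(\<lambda>y. z - y) ` interior K \<subseteq> Q" unfolding Q_def by (meson hull_subset order_trans)
    show "z - k \<in> (\<lambda>y. z - y) ` interior K" using assms(2) by (rule imageI)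
  qed
  moreover have "- (z - k) \<notin> Q"
  proof
    assume "- (z - k) \<in> Q"
    then obtain t y where t: "- (z - k) = t *\<^sub>R (z - y)" "0 \<le> t" "y \<in> K"
      by (auto simp: Q_def conic_hull_explicit)
    have "(1 + t) *\<^sub>R z = k + t *\<^sub>R y" using t(1) by (simp add: algebra_simps)
    have "z = (1 / (1 + t)) *\<^sub>R ((1 + t) *\<^sub>R z)"
      using t(2) by simp
    also have "\<dots> = (1 / (1 + t)) *\<^sub>R (k + t *\<^sub>R y)"
      unfolding \<open>(1 + t) *\<^sub>R z = k + t *\<^sub>R y\<close> ..
    also have "\<dots> = (1 - 1 / (1 + t)) *\<^sub>R y + (1 / (1 + t)) *\<^sub>R k"
      using t(2) by (simp add: algebra_simps field_simps)
    also have "\<dots> \<in> interior K"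
      using t by (intro convex_shrink_interior assms) auto
    finally show False using assms(3) by simp
  qed
  ultimately obtain f :: "'b \<Rightarrow>\<^sub>L real"
    where f: "blinfun_apply f (z - k) = 1" "\<And>x. x \<in> Q \<Longrightarrow> 0 \<le> blinfun_apply f x"
    using cone_positive_functional by blast
  show thesis
  proof (rule that)
    show "f \<noteq> 0" using f(1) by auto
    fix y assume "y \<in> K"
    then have "z - y \<in> Q" unfolding Q_def by (intro hull_inc) auto
    then show "blinfun_apply f y \<le> blinfun_apply f z"
      using f(2)[of "z - y"] by (simp add: blinfun.diff_right)
  qed
qed

section \<open>Monotone operators and normal cones\<close>

lemma pairing_convex_combination:
  fixes a b :: "'a::real_normed_vector" and a' b' :: "'a dual"
  shows "pairing ((1 - t) *\<^sub>R a + t *\<^sub>R b) ((1 - t) *\<^sub>R a' + t *\<^sub>R b') =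
    (1 - t) * pairing a a' + t * pairing b b' - t * (1 - t) * pairing (a - b) (a' - b')"
  by (simp add: blinfun.bilinear_simps algebra_simps)

lemma op_sum_normal_coneI:
  assumes "(b, b') \<in> A" "(b, m) \<in> normal_cone C" "0 \<le> c"
  shows "(b, b' + c *\<^sub>R m) \<in> op_sum A (normal_cone C)"
proof -
  have "(b, c *\<^sub>R m) \<in> normal_cone C"
    using assms(2,3) by (simp add: normal_cone_def blinfun.scaleR_left mult_nonneg_nonpos)
  then show ?thesis using assms(1) unfolding op_sum_def by blast
qed

lemma op_sum_normal_cone_restrict:
  assumes "(b, b') \<in> A" "b \<in> C"
  shows "(b, b') \<in> op_sum A (normal_cone C)"
  using op_sum_normal_coneI[OF assms(1), of 0 C 0] assms(2) by (simp add: normal_cone_def)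

lemma monotone_op_sum_normal_cone:
  assumes "monotone_op A"
  shows "monotone_op (op_sum A (normal_cone C))"
  unfolding monotone_op_def
proof (intro allI impI)
  fix x x' y y' assume "(x, x') \<in> op_sum A (normal_cone C)" "(y, y') \<in> op_sum A (normal_cone C)"
  then obtain a m b n where *: "x' = a + m" "y' = b + n" "(x, a) \<in> A" "(y, b) \<in> A"
    "(x, m) \<in> normal_cone C" "(y, n) \<in> normal_cone C"
    unfolding op_sum_def by auto
  have "0 \<le> pairing (x - y) (a - b)" using assms * by (auto simp: monotone_op_def)
  moreover have "pairing (y - x) m \<le> 0" "pairing (x - y) n \<le> 0"
    using *(5,6) by (auto simp: normal_cone_def)
  ultimately show "0 \<le> pairing (x - y) (x' - y')"
    using *(1,2) by (simp add: blinfun.bilinear_simps)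
qed

lemma maximal_monotone_opI:
  assumes "monotone_op T"
    and "\<And>x x'. monotonically_related (x, x') T \<Longrightarrow> (x, x') \<in> T"
  shows "maximal_monotone_op T"
  unfolding maximal_monotone_op_def
proof (intro conjI notI)
  assume "\<exists>B. monotone_op B \<and> T \<subset> B"
  then obtain B x x' where "monotone_op B" "T \<subset> B" "(x, x') \<in> B" "(x, x') \<notin> T" by auto
  then have "monotonically_related (x, x') T"
    unfolding monotonically_related_def monotone_op_def by auto
  then show False using assms(2) \<open>(x, x') \<notin> T\<close> by blast
qed (rule assms)

lemma maximal_monotone_opD:
  assumes "maximal_monotone_op T" "monotonically_related (x, x') T"
  shows "(x, x') \<in> T"
proof (rule ccontr)
  assume "(x, x') \<notin> T"
  have mono: "monotone_op T" using assms(1) by (simp add: maximal_monotone_op_def)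
  have rel: "0 \<le> pairing (x - s) (x' - s')" if "(s, s') \<in> T" for s s'
    using assms(2) that by (auto simp: monotonically_related_def)
  have "0 \<le> pairing (s - x) (s' - x')" if "(s, s') \<in> T" for s s'
    using rel[OF that] by (simp add: blinfun.bilinear_simps)
  then have "monotone_op (insert (x, x') T)"
    using mono rel unfolding monotone_op_def by auto
  then show False
    using assms(1) \<open>(x, x') \<notin> T\<close> unfolding maximal_monotone_op_def by blast
qed

text \<open>
  The point of this is that \<open>cen {}\<close> is the whole space, so a point of \<open>cen S\<close> belongs to \<open>S\<close> only
  when \<open>S\<close> is nonempty.
\<close>
lemma maximal_monotone_op_dom_nonempty:
  assumes "maximal_monotone_op T"
  shows "op_dom T \<noteq> {}"
proof
  assume "op_dom T = {}"
  then have "monotonically_related (0, 0) T"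
    by (auto simp: op_dom_def monotonically_related_def)
  then have "(0, 0) \<in> T" by (rule maximal_monotone_opD[OF assms])
  then show False using \<open>op_dom T = {}\<close> by (auto simp: op_dom_def)
qed

lemma cen_subset: "S \<noteq> {} \<Longrightarrow> cen S \<subseteq> S"
  by (auto simp: cen_def)

text \<open>
  The values of the sum at \<open>b\<close> contain the whole ray \<open>b' + c m\<close>, \<open>c \<ge> 0\<close>, and a positive
  \<open>m(x - b)\<close> would make the pairing tend to \<open>- \<infinity>\<close> along it.
\<close>
lemma monotonically_related_normal_direction:
  assumes rel: "monotonically_related (x, x') (op_sum A (normal_cone C))"
    and "(b, b') \<in> A" "(b, m) \<in> normal_cone C"
  shows "pairing (x - b) m \<le> 0"
proof (rule ccontr)
  let ?k = "pairing (x - b) (x' - b')"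
  assume "\<not> pairing (x - b) m \<le> 0"
  then have pos: "0 < pairing (x - b) m" by simp
  define c where "c = (\<bar>?k\<bar> + 1) / pairing (x - b) m"
  have "(b, b' + c *\<^sub>R m) \<in> op_sum A (normal_cone C)"
    using pos by (intro op_sum_normal_coneI assms) (simp add: c_def)
  then have "0 \<le> pairing (x - b) (x' - (b' + c *\<^sub>R m))"
    using rel by (auto simp: monotonically_related_def)
  also have "\<dots> = ?k - c * pairing (x - b) m" by (simp add: blinfun.bilinear_simps algebra_simps)
  also have "\<dots> = ?k - (\<bar>?k\<bar> + 1)" using pos by (simp add: c_def)
  finally show False by linarith
qed

section \<open>Points related to the sum lie in the constraint set\<close>

text \<open>
  A supporting functional exceeds its value at \<open>p\<close> by at least \<open>r\<close> times its norm. Both parts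
  express this without the operator norm: test the support inequality at the point \<open>p + (r / norm v) v\<close>
  of the ball.
\<close>
lemma supporting_functional_gap:
  fixes C :: "'a::real_normed_vector set"
  assumes "m \<noteq> 0" "\<And>y. y \<in> C \<Longrightarrow> pairing y m \<le> pairing b m" "cball p r \<subseteq> C" "0 < r"
  shows "r * pairing v m \<le> norm v * pairing (b - p) m" "0 < pairing (b - p) m"
proof -
  show *: "r * pairing v m \<le> norm v * pairing (b - p) m" for v
  proof (cases "v = 0")
    case False
    have "p + (r / norm v) *\<^sub>R v \<in> cball p r" using False \<open>0 < r\<close> by (simp add: dist_norm)
    then have "pairing (p + (r / norm v) *\<^sub>R v) m \<le> pairing b m" using assms by blast
    then show ?thesis using False by (simp add: blinfun.bilinear_simps field_simps)
  qed simp
  obtain v where v: "pairing v m \<noteq> 0" using assms(1) by (metis blinfun_eqI zero_blinfun.rep_eq)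
  define w where "w = (if pairing v m > 0 then v else - v)"
  have "0 < r * pairing w m" using v \<open>0 < r\<close> by (simp add: w_def blinfun.bilinear_simps)
  then have "0 < norm w * pairing (b - p) m" using *[of w] by linarith
  then show "0 < pairing (b - p) m"
    by (metis norm_ge_zero zero_less_mult_iff not_le)
qed

text \<open>
  If the tube had a point \<open>a\<close> of the domain outside \<open>C\<close>, the segment from \<open>p\<close> to \<open>a\<close> would cross the
  boundary of \<open>C\<close> at a point \<open>b\<close> of the domain, close to the segment from \<open>p\<close> to \<open>x\<close> and away from
  \<open>x\<close>. Seen from \<open>p\<close>, the point \<open>x\<close> is then beyond \<open>b\<close> in nearly the same direction, hence strictly
  on the outer side of a hyperplane supporting \<open>C\<close> at \<open>b\<close>.
\<close>
lemma domain_tube_subset: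
  fixes A :: "'a::real_normed_vector operator"
  assumes "closed C" "convex C" "p \<in> cen (op_dom A)" "p \<in> interior C" "x \<notin> C"
    and rel: "monotonically_related (x, x') (op_sum A (normal_cone C))"
  obtains V where "open V" "convex V" "x \<in> V" "p \<in> V" "V \<inter> op_dom A \<subseteq> C"
proof -
  obtain r where "0 < r" and r: "cball p r \<subseteq> C"
    using assms(4) by (auto simp: mem_interior_cball)
  have "p \<in> C" using assms(4) interior_subset by blast
  obtain d where "0 < d" and d: "\<And>y. y \<in> C \<Longrightarrow> d \<le> dist x y"
  proof -
    have "open (- C)" "x \<in> - C" using assms by auto
    then obtain d where "d > 0" "ball x d \<subseteq> - C" by (meson openE)
    then show thesis using that[of d] by (metis ComplD in_mono mem_ball not_less)
  qed
  define L where "L = norm (x - p)"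
  have "0 < L" using \<open>p \<in> C\<close> assms(5) by (auto simp: L_def)
  \<comment> \<open>The crossing point is at distance at least \<open>d\<close> from \<open>x\<close>, so its parameter along \<open>x - p\<close> falls
    short of 1 by at least \<open>(d - \<delta>) / L\<close>; this has to beat the sideways deviation \<open>\<delta> / r\<close>.\<close>
  define \<delta> where "\<delta> = d * r / (2 * (L + r))"
  have "0 < \<delta>" using \<open>0 < d\<close> \<open>0 < r\<close> \<open>0 < L\<close> by (simp add: \<delta>_def)
  have "2 * \<delta> * (L + r) = d * r" using \<open>0 < r\<close> \<open>0 < L\<close> by (simp add: \<delta>_def field_simps)
  then have \<delta>: "\<delta> * (L + r) < d * r"
    using mult_pos_pos[OF \<open>0 < \<delta>\<close> add_pos_pos[OF \<open>0 < L\<close> \<open>0 < r\<close>]] by linarith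
  define V where "V = (\<Union>u\<in>closed_segment p x. \<Union>v\<in>ball 0 \<delta>. {u + v})"
  have seg: "u \<in> V" if "u \<in> closed_segment p x" for u
    using that \<open>0 < \<delta>\<close> unfolding V_def by force
  show thesis
  proof (rule that)
    show "open V" unfolding V_def by (intro open_sums) auto
    show "convex V" unfolding V_def by (intro convex_sums) auto
    show "x \<in> V" "p \<in> V" by (auto intro: seg)
    show "V \<inter> op_dom A \<subseteq> C"
    proof (intro subsetI, rule ccontr)
      fix a assume a: "a \<in> V \<inter> op_dom A" "a \<notin> C"
      then obtain \<tau> e where \<tau>: "0 \<le> \<tau>" "\<tau> \<le> 1" and e: "norm e < \<delta>"
        and ae: "a = (1 - \<tau>) *\<^sub>R p + \<tau> *\<^sub>R x + e"
        by (auto simp: V_def in_segment)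
      have "closed_segment p a \<inter> frontier C \<noteq> {}"
        using a(2) \<open>p \<in> C\<close> by (intro connected_Int_frontier) auto
      then obtain b where b: "b \<in> closed_segment p a" "b \<in> frontier C" by blast
      then have "b \<in> C" "b \<notin> interior C" using assms(1) by (auto simp: frontier_def)
      obtain \<sigma> where \<sigma>: "0 \<le> \<sigma>" "\<sigma> \<le> 1" and b\<sigma>: "b = (1 - \<sigma>) *\<^sub>R p + \<sigma> *\<^sub>R a"
        using b(1) by (auto simp: in_segment)
      have "b \<in> op_dom A" using b(1) a(1) assms(3) by (auto simp: cen_def)
      then obtain b' where b': "(b, b') \<in> A" by (auto simp: op_dom_def)
      obtain m :: "'a dual" where "m \<noteq> 0" and m: "\<And>y. y \<in> C \<Longrightarrow> pairing y m \<le> pairing b m"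
        using supporting_functional[OF assms(2,4) \<open>b \<notin> interior C\<close>] by blast
      have gap: "r * pairing v m \<le> norm v * pairing (b - p) m" "0 < pairing (b - p) m" for v
        using supporting_functional_gap[OF \<open>m \<noteq> 0\<close> m r \<open>0 < r\<close>] by auto
      have "(b, m) \<in> normal_cone C"
        using \<open>b \<in> C\<close> m by (auto simp: normal_cone_def blinfun.bilinear_simps)
      then have "pairing (x - b) m \<le> 0"
        by (rule monotonically_related_normal_direction[OF rel b'])
      then have le0: "(\<sigma> * \<tau>) * pairing (x - b) m \<le> 0"
        using \<sigma> \<tau> by (simp add: mult_nonneg_nonpos)
      have bp: "b - p = (\<sigma> * \<tau>) *\<^sub>R (x - p) + \<sigma> *\<^sub>R e"
        unfolding b\<sigma> ae by (simp add: algebra_simps)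
      have bx: "x - b = (1 - \<sigma> * \<tau>) *\<^sub>R (x - p) - \<sigma> *\<^sub>R e"
        unfolding b\<sigma> ae by (simp add: algebra_simps)
      have "\<sigma> * \<tau> \<le> 1" using \<sigma> \<tau> by (simp add: mult_le_one)
      have \<sigma>e: "norm (\<sigma> *\<^sub>R e) \<le> \<delta>"
        using \<sigma> e mult_left_le_one_le[of "norm e" \<sigma>] by simp
      have "d \<le> norm (x - b)" using d[OF \<open>b \<in> C\<close>] by (simp add: dist_norm)
      also have "\<dots> \<le> (1 - \<sigma> * \<tau>) * L + \<delta>"
        unfolding bx using norm_triangle_ineq4[of "(1 - \<sigma> * \<tau>) *\<^sub>R (x - p)" "\<sigma> *\<^sub>R e"] \<sigma>e \<open>\<sigma> * \<tau> \<le> 1\<close>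
        by (simp add: L_def)
      finally have "d * r \<le> ((1 - \<sigma> * \<tau>) * L + \<delta>) * r" using \<open>0 < r\<close> by simp
      then have "\<delta> * L < (1 - \<sigma> * \<tau>) * r * L" using \<delta> by (simp add: algebra_simps)
      then have *: "\<delta> < (1 - \<sigma> * \<tau>) * r" using \<open>0 < L\<close> by simp
      \<comment> \<open>Eliminating \<open>x - p\<close> between the two formulas compares \<open>m(x - b)\<close> with \<open>m(b - p) > 0\<close>. The factor
        \<open>\<sigma> * \<tau>\<close> is kept, which avoids showing that it is nonzero.\<close>
      have "(\<sigma> * \<tau>) *\<^sub>R (x - b) = (1 - \<sigma> * \<tau>) *\<^sub>R (b - p) - \<sigma> *\<^sub>R e"
        using bp by (simp add: algebra_simps)
      then have "(\<sigma> * \<tau>) * pairing (x - b) m = (1 - \<sigma> * \<tau>) * pairing (b - p) m - pairing (\<sigma> *\<^sub>R e) m"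
        by (metis blinfun.diff_right blinfun.scaleR_right real_scaleR_def)
      then have "r * ((1 - \<sigma> * \<tau>) * pairing (b - p) m) \<le> r * pairing (\<sigma> *\<^sub>R e) m"
        using le0 \<open>0 < r\<close> by simp
      also have "\<dots> \<le> norm (\<sigma> *\<^sub>R e) * pairing (b - p) m" by (rule gap)
      also have "\<dots> \<le> \<delta> * pairing (b - p) m" using \<sigma>e gap(2) by simp
      finally have "((1 - \<sigma> * \<tau>) * r) * pairing (b - p) m \<le> \<delta> * pairing (b - p) m"
        by (simp add: algebra_simps)
      then show False using * gap(2) by simp
    qed
  qed
qed

text \<open>
  In the tube the domain of \<open>A\<close> lies in \<open>C\<close>, where \<open>0\<close> is a normal vector, so the point is related to
  the restriction of \<open>A\<close>. Weak (FPV) puts \<open>x\<close> into the domain, and the tube excludes this outside \<open>C\<close>.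
\<close>
lemma monotonically_related_in_constraint:
  fixes A :: "'a::real_normed_vector operator"
  assumes "closed C" "convex C" "weak_FPV A" "p \<in> cen (op_dom A)" "p \<in> op_dom A" "p \<in> interior C"
    and rel: "monotonically_related (x, x') (op_sum A (normal_cone C))"
  shows "x \<in> C"
proof (rule ccontr)
  assume "x \<notin> C"
  then obtain V where V: "open V" "convex V" "x \<in> V" "p \<in> V" "V \<inter> op_dom A \<subseteq> C"
    using domain_tube_subset[OF assms(1,2,4,6) _ rel] by blast
  have "(a, a') \<in> op_sum A (normal_cone C)" if "(a, a') \<in> op_restrict A V" for a a'
  proof -
    have "(a, a') \<in> A" "a \<in> C" using that V(5) by (auto simp: op_restrict_def op_dom_def)
    then show ?thesis by (rule op_sum_normal_cone_restrict)
  qed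
  then have "monotonically_related (x, x') (op_restrict A V)"
    using rel unfolding monotonically_related_def by blast
  then have "x \<in> op_dom A"
    using assms(3,5) V unfolding weak_FPV_def by blast
  then show False using V \<open>x \<notin> C\<close> by blast
qed

section \<open>No point is uniformly strictly related to the sum\<close>

text \<open>
  Weak (FPV) can be applied on the open set \<open>interior C\<close>, where \<open>A\<close> is contained in the sum, but the
  base point may lie on the boundary of \<open>C\<close>. The slack \<open>\<epsilon>\<close> pays for moving it inside, towards \<open>p\<close>.
\<close>
lemma op_sum_normal_cone_almost_unrelated:
  fixes A :: "'a::real_normed_vector operator"
  assumes "closed C" "convex C" "monotone_op A" "weak_FPV A"
    and "p \<in> cen (op_dom A)" "p \<in> op_dom A" "p \<in> interior C" "0 < \<epsilon>"
  obtains b b' where "(b, b') \<in> op_sum A (normal_cone C)" "pairing (x - b) (x' - b') < \<epsilon>"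
proof -
  let ?T = "op_sum A (normal_cone C)"
  have "\<exists>b b'. (b, b') \<in> ?T \<and> pairing (x - b) (x' - b') < \<epsilon>"
  proof (rule ccontr)
    assume "\<nexists>b b'. (b, b') \<in> ?T \<and> pairing (x - b) (x' - b') < \<epsilon>"
    then have far: "\<epsilon> \<le> pairing (x - b) (x' - b')" if "(b, b') \<in> ?T" for b b'
      using that not_less by blast
    have "monotonically_related (x, x') ?T"
      using far \<open>0 < \<epsilon>\<close> unfolding monotonically_related_def by force
    then have "x \<in> C"
      using monotonically_related_in_constraint[OF assms(1,2,4-7)] by blast
    obtain p' where p': "(p, p') \<in> A" using assms(6) by (auto simp: op_dom_def)
    have "p \<in> C" using assms(7) interior_subset by blast
    have pT: "(p, p') \<in> ?T" using op_sum_normal_cone_restrict[OF p' \<open>p \<in> C\<close>] .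
    define k where "k = pairing (p - x) (p' - x')"
    \<comment> \<open>The step length towards \<open>p\<close>; the quadratic error term of the move is \<open>s (1 - s) k\<close>, which is
      covered by \<open>(1 - s) \<epsilon>\<close> when \<open>s k < \<epsilon>\<close>.\<close>
    define s where "s = \<epsilon> / (2 * (\<bar>k\<bar> + \<epsilon>))"
    have "0 < \<bar>k\<bar> + \<epsilon>" using \<open>0 < \<epsilon>\<close> by linarith
    have s: "0 < s" "s < 1" using \<open>0 < \<epsilon>\<close> by (auto simp: s_def field_simps)
    have sk: "s * k < \<epsilon>"
    proof -
      have "2 * s * (\<bar>k\<bar> + \<epsilon>) = \<epsilon>" using \<open>0 < \<bar>k\<bar> + \<epsilon>\<close> by (simp add: s_def field_simps)
      then have "2 * (s * \<bar>k\<bar>) < \<epsilon>" using mult_pos_pos[OF s(1) \<open>0 < \<epsilon>\<close>] by (simp add: algebra_simps)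
      moreover have "s * k \<le> s * \<bar>k\<bar>" "0 \<le> s * \<bar>k\<bar>" using s by (auto intro: mult_left_mono)
      ultimately show ?thesis by linarith
    qed
    define y where "y = (1 - s) *\<^sub>R x + s *\<^sub>R p"
    define y' where "y' = (1 - s) *\<^sub>R x' + s *\<^sub>R p'"
    have pos: "0 < pairing (y - b) (y' - b')" if bT: "(b, b') \<in> ?T" for b b'
    proof -
      have "y - b = (1 - s) *\<^sub>R (x - b) + s *\<^sub>R (p - b)"
        "y' - b' = (1 - s) *\<^sub>R (x' - b') + s *\<^sub>R (p' - b')"
        by (auto simp: y_def y'_def algebra_simps)
      then have eq: "pairing (y - b) (y' - b') = (1 - s) * pairing (x - b) (x' - b')
          + s * pairing (p - b) (p' - b') - s * (1 - s) * pairing (x - p) (x' - p')"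
        using pairing_convex_combination[of s "x' - b'" "p' - b'" "x - b" "p - b"] by simp
      have xpk: "pairing (x - p) (x' - p') = k"
        by (simp add: k_def blinfun.bilinear_simps)
      have "0 \<le> s * pairing (p - b) (p' - b')"
        using monotone_op_sum_normal_cone[OF assms(3), of C] pT bT s by (auto simp: monotone_op_def)
      moreover have "(1 - s) * \<epsilon> \<le> (1 - s) * pairing (x - b) (x' - b')"
        using far[OF bT] s by simp
      moreover have "(1 - s) * (s * k) < (1 - s) * \<epsilon>" using sk s by simp
      moreover have "s * (1 - s) * k = (1 - s) * (s * k)" by simp
      ultimately show ?thesis using eq unfolding xpk by linarith
    qed
    have yC: "y \<in> interior C"
      unfolding y_def using assms(2,7) \<open>x \<in> C\<close> s by (intro convex_shrink_interior) auto
    then have "y \<in> C" using interior_subset by blast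
    have "0 \<le> pairing (y - a) (y' - a')" if "(a, a') \<in> op_restrict A (interior C)" for a a'
    proof -
      have "(a, a') \<in> A" "a \<in> C" using that interior_subset by (auto simp: op_restrict_def)
      then show ?thesis using pos[OF op_sum_normal_cone_restrict] by fastforce
    qed
    then have "monotonically_related (y, y') (op_restrict A (interior C))"
      unfolding monotonically_related_def by auto
    moreover have "open (interior C)" "convex (interior C)" "interior C \<inter> op_dom A \<noteq> {}"
      using assms by auto
    ultimately have "y \<in> op_dom A"
      using assms(4) yC unfolding weak_FPV_def by blast
    then obtain a' where "(y, a') \<in> A" by (auto simp: op_dom_def)
    then show False using pos[OF op_sum_normal_cone_restrict[OF _ \<open>y \<in> C\<close>], of a'] by simp
  qed
  then show thesis using that by blast
qed

section \<open>Convex combinations of graph points\<close>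

text \<open>
  The third component records the same convex combination of the pairings as is taken of the graph
  points themselves. For given \<open>y\<close> and \<open>v\<close>, the values \<open>s\<close> are those over which the infimum is
  taken in the largest convex function bounded by the pairing on the graph.
\<close>
definition graph_hull :: "'a::real_normed_vector operator \<Rightarrow> ('a \<times> 'a dual \<times> real) set" where
  "graph_hull A = convex hull ((\<lambda>(a, a'). (a, a', pairing a a')) ` A)"

lemma graph_hullI: "(a, a') \<in> A \<Longrightarrow> (a, a', pairing a a') \<in> graph_hull A"
  unfolding graph_hull_def by (intro hull_inc) force

text \<open>
  For fixed \<open>(b, b')\<close> the inequality is affine in \<open>(y, v, s)\<close>, once \<open>pairing y v\<close> is cancelled, and on
  the generators it is monotonicity.
\<close>
lemma graph_hull_monotone:
  assumes "(y, v, s) \<in> graph_hull A" "monotone_op A" "(b, b') \<in> A"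
  shows "pairing y v - s \<le> pairing (y - b) (v - b')"
proof -
  let ?S = "{(y, v, s). 0 \<le> pairing b b' - pairing b v - pairing y b' + s}"
  have "convex ?S"
  proof (rule convexI)
    fix w1 w2 and t u :: real
    assume "w1 \<in> ?S" "w2 \<in> ?S" and tu: "0 \<le> t" "0 \<le> u" "t + u = 1"
    then obtain y v s z w r where w: "w1 = (y, v, s)" "w2 = (z, w, r)"
      and "0 \<le> pairing b b' - pairing b v - pairing y b' + s"
        "0 \<le> pairing b b' - pairing b w - pairing z b' + r" by auto
    then have "0 \<le> t * (pairing b b' - pairing b v - pairing y b' + s)
        + u * (pairing b b' - pairing b w - pairing z b' + r)"
      using tu by simp
    moreover have "t * pairing b b' + u * pairing b b' = pairing b b'"
      using tu by (metis distrib_right mult_1)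
    ultimately show "t *\<^sub>R w1 + u *\<^sub>R w2 \<in> ?S"
      using w by (simp add: blinfun.bilinear_simps algebra_simps)
  qed
  moreover have "(\<lambda>(a, a'). (a, a', pairing a a')) ` A \<subseteq> ?S"
  proof clarify
    fix a a' assume "(a, a') \<in> A"
    then have "0 \<le> pairing (a - b) (a' - b')" using assms by (auto simp: monotone_op_def)
    then show "0 \<le> pairing b b' - pairing b a' - pairing a b' + pairing a a'"
      by (simp add: blinfun.bilinear_simps)
  qed
  ultimately have "graph_hull A \<subseteq> ?S" unfolding graph_hull_def by (rule hull_minimal[rotated])
  then show ?thesis using assms(1) by (auto simp: blinfun.bilinear_simps)
qed

text \<open>
  On the segment from \<open>z = (x, x')\<close> to \<open>Q = (y, v)\<close>, the pairing of \<open>(1 - t) z + t Q - \<beta>\<close> with \<open>\<beta>\<close> in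
  the sum is at least \<open>- t (S + (1 - t) k)\<close>. Since it can be made smaller than any \<open>\<epsilon> > 0\<close>, the
  bracket is nonnegative; its limit at \<open>t = 0\<close> is the claim. The hypothesis \<open>y \<in> C\<close> gives
  the normal vector in \<open>\<beta>\<close> the right sign.
\<close>
lemma monotonically_related_graph_hull:
  fixes A :: "'a::real_normed_vector operator"
  assumes "closed C" "convex C" "monotone_op A" "weak_FPV A"
    and "p \<in> cen (op_dom A)" "p \<in> op_dom A" "p \<in> interior C"
    and rel: "monotonically_related (x, x') (op_sum A (normal_cone C))"
    and h: "(y, v, s) \<in> graph_hull A" "y \<in> C"
  shows "0 \<le> pairing x x' - pairing x v - pairing y x' + s"
proof -
  let ?T = "op_sum A (normal_cone C)"
  define S where "S = s - pairing y v"
  define k where "k = pairing (x - y) (x' - v)"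
  have "0 \<le> S + (1 - t) * k" if t: "0 < t" "t < 1" for t
  proof -
    have "0 \<le> t * S + t * (1 - t) * k"
    proof (rule field_le_epsilon)
      fix \<epsilon> :: real assume "0 < \<epsilon>"
      define w where "w = (1 - t) *\<^sub>R x + t *\<^sub>R y"
      define w' where "w' = (1 - t) *\<^sub>R x' + t *\<^sub>R v"
      obtain b c where bT: "(b, c) \<in> ?T" and lt: "pairing (w - b) (w' - c) < \<epsilon>"
        using op_sum_normal_cone_almost_unrelated[OF assms(1-7) \<open>0 < \<epsilon>\<close>] by blast
      obtain b' n where bn: "c = b' + n" "(b, b') \<in> A" "(b, n) \<in> normal_cone C"
        using bT by (auto simp: op_sum_def)
      have "w - b = (1 - t) *\<^sub>R (x - b) + t *\<^sub>R (y - b)" "w' - c = (1 - t) *\<^sub>R (x' - c) + t *\<^sub>R (v - c)"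
        by (auto simp: w_def w'_def algebra_simps)
      then have eq: "pairing (w - b) (w' - c) = (1 - t) * pairing (x - b) (x' - c)
          + t * pairing (y - b) (v - c) - t * (1 - t) * k"
        using pairing_convex_combination[of t "x' - c" "v - c" "x - b" "y - b"] by (simp add: k_def)
      have "0 \<le> pairing (x - b) (x' - c)"
        using rel bT by (auto simp: monotonically_related_def)
      then have 1: "0 \<le> (1 - t) * pairing (x - b) (x' - c)" using t by simp
      have "pairing (y - b) n \<le> 0" using bn(3) h(2) by (auto simp: normal_cone_def)
      then have "pairing (y - b) (v - b') \<le> pairing (y - b) (v - c)"
        by (simp add: bn(1) blinfun.bilinear_simps)
      then have "- S \<le> pairing (y - b) (v - c)"
        using graph_hull_monotone[OF h(1) assms(3) bn(2)] by (simp add: S_def)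
      then have "t * (- S) \<le> t * pairing (y - b) (v - c)" using t by (intro mult_left_mono) auto
      then show "0 \<le> t * S + t * (1 - t) * k + \<epsilon>" using 1 eq lt by simp
    qed
    then have "0 \<le> t * (S + (1 - t) * k)" by (simp add: algebra_simps)
    then show ?thesis using t by (simp add: zero_le_mult_iff)
  qed
  then have "eventually (\<lambda>t. 0 \<le> S + (1 - t) * k) (at_right 0)"
    unfolding eventually_at_right_field by (intro exI[of _ 1]) auto
  moreover have "((\<lambda>t. S + (1 - t) * k) \<longlongrightarrow> S + (1 - 0) * k) (at_right 0)"
    by (intro tendsto_intros)
  ultimately have "0 \<le> S + (1 - 0) * k"
    by (intro tendsto_lowerbound[of _ _ "at_right (0::real)"]) auto
  then show ?thesis by (simp add: S_def k_def blinfun.bilinear_simps)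
qed

section \<open>Splitting off a normal vector\<close>

text \<open>
  The assumption says that a convex function on the hull of the domain lies above the concave
  function that is \<open>0\<close> on \<open>C\<close> and \<open>- \<infinity>\<close> elsewhere; \<open>- u\<close> is the slope of an affine function between
  the two. It is found by separating the
  origin from the convex set \<open>K\<close> of differences \<open>(y - c, r)\<close>, with \<open>r\<close> above the convex function at
  \<open>y\<close>. As \<open>p\<close> is a point of the domain in the interior of \<open>C\<close>, the set \<open>K\<close> has interior points and
  the separating hyperplane is not vertical.
\<close>
lemma sandwich_functional:
  fixes A :: "'a::real_normed_vector operator"
  assumes "convex C" "p \<in> op_dom A" "p \<in> interior C"
    and nonneg: "\<And>y v s. (y, v, s) \<in> graph_hull A \<Longrightarrow> y \<in> C
      \<Longrightarrow> 0 \<le> pairing x x' - pairing x v - pairing y x' + s"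
  obtains u :: "'a dual" where
    "\<And>a a' c. (a, a') \<in> A \<Longrightarrow> c \<in> C \<Longrightarrow> 0 \<le> pairing (x - a) (x' - a') + pairing (a - c) u"
proof -
  define q where "q y v s = pairing x x' - pairing x v - pairing y x' + s"
    for y :: 'a and v :: "'a dual" and s :: real
  have qA: "q a a' (pairing a a') = pairing (x - a) (x' - a')" for a a'
    by (simp add: q_def blinfun.bilinear_simps)
  define K where "K = {(y - c, r) | y v s c r. (y, v, s) \<in> graph_hull A \<and> c \<in> C \<and> q y v s < r}"
  have KI: "(y - c, r) \<in> K" if "(y, v, s) \<in> graph_hull A" "c \<in> C" "q y v s < r" for y v s c r
    using that unfolding K_def by blast
  have "convex K"
  proof (rule convexI)
    fix w1 w2 and t u :: real
    assume K12: "w1 \<in> K" "w2 \<in> K" and tu: "0 \<le> t" "0 \<le> u" "t + u = 1"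
    obtain y1 v1 s1 c1 r1 where 1: "w1 = (y1 - c1, r1)" "(y1, v1, s1) \<in> graph_hull A" "c1 \<in> C" "q y1 v1 s1 < r1"
      using K12(1) unfolding K_def by blast
    obtain y2 v2 s2 c2 r2 where 2: "w2 = (y2 - c2, r2)" "(y2, v2, s2) \<in> graph_hull A" "c2 \<in> C" "q y2 v2 s2 < r2"
      using K12(2) unfolding K_def by blast
    have "t *\<^sub>R (y1, v1, s1) + u *\<^sub>R (y2, v2, s2) \<in> graph_hull A"
      using 1 2 tu unfolding graph_hull_def by (intro convexD[OF convex_convex_hull]) auto
    then have H: "(t *\<^sub>R y1 + u *\<^sub>R y2, t *\<^sub>R v1 + u *\<^sub>R v2, t * s1 + u * s2) \<in> graph_hull A" by simp
    have Cc: "t *\<^sub>R c1 + u *\<^sub>R c2 \<in> C" using 1 2 tu by (intro convexD[OF assms(1)])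
    have "t * pairing x x' + u * pairing x x' = pairing x x'"
      using tu by (metis distrib_right mult_1)
    then have "q (t *\<^sub>R y1 + u *\<^sub>R y2) (t *\<^sub>R v1 + u *\<^sub>R v2) (t * s1 + u * s2) = t * q y1 v1 s1 + u * q y2 v2 s2"
      by (simp add: q_def blinfun.bilinear_simps algebra_simps)
    also have "\<dots> < t * r1 + u * r2"
    proof (cases "t = 0")
      case True
      then show ?thesis using 2 tu by simp
    next
      case False
      then have "t * q y1 v1 s1 < t * r1" using 1 tu by simp
      moreover have "u * q y2 v2 s2 \<le> u * r2" using 2 tu by (intro mult_left_mono) auto
      ultimately show ?thesis by linarith
    qed
    finally have "((t *\<^sub>R y1 + u *\<^sub>R y2) - (t *\<^sub>R c1 + u *\<^sub>R c2), t * r1 + u * r2) \<in> K"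
      using KI[OF H Cc] by blast
    then show "t *\<^sub>R w1 + u *\<^sub>R w2 \<in> K" using 1 2 by (simp add: algebra_simps)
  qed
  obtain p' where p': "(p, p') \<in> A" using assms(2) by (auto simp: op_dom_def)
  define q0 where "q0 = pairing (x - p) (x' - p')"
  have KP: "(p - c, r) \<in> K" if "c \<in> C" "q0 < r" for c r
    using KI[OF graph_hullI[OF p'] that(1)] that(2) qA by (simp add: q0_def)
  have "(0, q0 + 1) \<in> interior K"
  proof (rule interiorI)
    show "open (((\<lambda>c. p - c) ` interior C) \<times> {q0<..})"
      using open_affinity[of "interior C" "-1" p] by (intro open_Times) simp_all
    show "((\<lambda>c. p - c) ` interior C) \<times> {q0<..} \<subseteq> K"
      using KP interior_subset by blast
    show "(0, q0 + 1) \<in> ((\<lambda>c. p - c) ` interior C) \<times> {q0<..}"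
      using assms(3) by (auto intro!: image_eqI[of _ _ p])
  qed
  moreover have "(0, 0) \<notin> interior K"
  proof
    assume "(0, 0) \<in> interior K"
    then have "(0, 0) \<in> K" using interior_subset by blast
    then obtain y v s where "(y, v, s) \<in> graph_hull A" "y \<in> C" "q y v s < 0"
      by (auto simp: K_def)
    then show False using nonneg by (fastforce simp: q_def)
  qed
  ultimately obtain f :: "('a \<times> real) \<Rightarrow>\<^sub>L real" where "f \<noteq> 0"
    and f: "\<And>w. w \<in> K \<Longrightarrow> blinfun_apply f w \<le> blinfun_apply f (0, 0)"
    using supporting_functional[OF \<open>convex K\<close>] by metis
  \<comment> \<open>Split the functional into its part \<open>l\<close> on the space and its slope \<open>\<gamma>\<close> in the real variable.\<close>
  define \<gamma> where "\<gamma> = blinfun_apply f (0, 1)"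
  define l where "l = Blinfun (\<lambda>w. blinfun_apply f (w, 0))"
  have "bounded_linear (\<lambda>w. blinfun_apply f (w, 0))"
    by (intro bounded_linear_compose[OF blinfun.bounded_linear_right]
        bounded_linear_Pair bounded_linear_ident bounded_linear_zero)
  then have l: "blinfun_apply l w = blinfun_apply f (w, 0)" for w
    by (simp add: l_def bounded_linear_Blinfun_apply)
  have split: "blinfun_apply f (w, r) = blinfun_apply l w + r * \<gamma>" for w r
  proof -
    have "(w, r) = (w, 0) + r *\<^sub>R (0, 1)" by simp
    then show ?thesis unfolding l \<gamma>_def by (metis blinfun.add_right blinfun.scaleR_right real_scaleR_def)
  qed
  have K: "blinfun_apply l w + r * \<gamma> \<le> 0" if "(w, r) \<in> K" for w r
    using f[OF that] split[of w r] split[of 0 0] by (simp add: blinfun.bilinear_simps)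
  have "p \<in> C" using assms(3) interior_subset by blast
  have "\<gamma> < 0"
  proof (rule ccontr)
    assume "\<not> \<gamma> < 0"
    moreover have "(q0 + 1) * \<gamma> \<le> 0" "(\<bar>q0\<bar> + 1) * \<gamma> \<le> 0"
      using K[of 0 "q0 + 1"] K[of 0 "\<bar>q0\<bar> + 1"] KP[OF \<open>p \<in> C\<close>] by (auto simp: blinfun.bilinear_simps)
    ultimately have "\<gamma> = 0" by (smt (verit) mult_pos_pos)
    have "l \<noteq> 0"
    proof
      assume "l = 0"
      then have "blinfun_apply f w = 0" for w using split[of "fst w" "snd w"] \<open>\<gamma> = 0\<close> by simp
      then show False using \<open>f \<noteq> 0\<close> by (metis blinfun_eqI zero_blinfun.rep_eq)
    qed
    obtain r where "0 < r" and r: "cball p r \<subseteq> C"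
      using assms(3) by (auto simp: mem_interior_cball)
    \<comment> \<open>A vertical hyperplane would make \<open>- l\<close> support \<open>C\<close> at its interior point \<open>p\<close>.\<close>
    have "pairing p l \<le> pairing c l" if "c \<in> C" for c
      using K[OF KP[OF that, of "q0 + 1"]] \<open>\<gamma> = 0\<close> by (simp add: blinfun.bilinear_simps)
    then have "0 < pairing (p - p) (- l)"
      using \<open>l \<noteq> 0\<close> r \<open>0 < r\<close> by (intro supporting_functional_gap(2)[of "- l" C p p r]) (auto simp: blinfun.bilinear_simps)
    then show False by simp
  qed
  show thesis
  proof (rule that)
    fix a a' c assume a: "(a, a') \<in> A" and c: "c \<in> C"
    let ?q = "pairing (x - a) (x' - a')"
    have "- ?q \<le> pairing (a - c) l / \<gamma> + \<epsilon>" if "0 < \<epsilon>" for \<epsilon>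
    proof -
      have "(a - c, ?q + \<epsilon>) \<in> K" using KI[OF graph_hullI[OF a] c] qA that by simp
      then have "pairing (a - c) l + (?q + \<epsilon>) * \<gamma> \<le> 0" by (rule K)
      then show ?thesis using \<open>\<gamma> < 0\<close> by (simp add: field_simps)
    qed
    then have "- ?q \<le> pairing (a - c) l / \<gamma>" by (rule field_le_epsilon)
    then show "0 \<le> ?q + pairing (a - c) ((1 / \<gamma>) *\<^sub>R l)" by (simp add: blinfun.scaleR_left)
  qed
qed

theorem theorem1:
  fixes A :: "'a::banach operator"
    and C :: "'a set"
  assumes "closed C"
    and "convex C"
    and "maximal_monotone_op A"
    and "weak_FPV A"
    and "cen (op_dom A) \<inter> interior C \<noteq> {}"
  shows "maximal_monotone_op (op_sum A (normal_cone C))"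
proof (rule maximal_monotone_opI)
  have mono: "monotone_op A" using assms(3) by (simp add: maximal_monotone_op_def)
  then show "monotone_op (op_sum A (normal_cone C))" by (rule monotone_op_sum_normal_cone)
  obtain p where p: "p \<in> cen (op_dom A)" "p \<in> interior C" using assms(5) by blast
  then have "p \<in> op_dom A"
    using cen_subset[OF maximal_monotone_op_dom_nonempty[OF assms(3)]] by blast
  note ctx = assms(1,2) mono assms(4) p(1) \<open>p \<in> op_dom A\<close> p(2)
  fix x x' assume rel: "monotonically_related (x, x') (op_sum A (normal_cone C))"
  \<comment> \<open>Taking \<open>c = x\<close> relates \<open>(x, x' - u)\<close> to \<open>A\<close>; once this point is known to be in \<open>A\<close>, taking it for
    \<open>(a, a')\<close> makes \<open>u\<close> normal to \<open>C\<close>.\<close>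
  obtain u where u: "\<And>a a' c. (a, a') \<in> A \<Longrightarrow> c \<in> C
      \<Longrightarrow> 0 \<le> pairing (x - a) (x' - a') + pairing (a - c) u"
    using sandwich_functional[OF assms(2) \<open>p \<in> op_dom A\<close> p(2)
        monotonically_related_graph_hull[OF ctx rel]] by blast
  have "x \<in> C"
    using monotonically_related_in_constraint[OF assms(1,2,4) p(1) \<open>p \<in> op_dom A\<close> p(2) rel] .
  have "0 \<le> pairing (x - a) ((x' - u) - a')" if "(a, a') \<in> A" for a a'
    using u[OF that \<open>x \<in> C\<close>] by (simp add: blinfun.bilinear_simps)
  then have "monotonically_related (x, x' - u) A"
    by (auto simp: monotonically_related_def)
  then have xA: "(x, x' - u) \<in> A" by (rule maximal_monotone_opD[OF assms(3)])
  have "(x, u) \<in> normal_cone C"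
    using u[OF xA] \<open>x \<in> C\<close> by (auto simp: normal_cone_def blinfun.bilinear_simps)
  then show "(x, x') \<in> op_sum A (normal_cone C)"
    using op_sum_normal_coneI[OF xA, of u C 1] by simp
qed

end
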